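(* Let $\{X_n,\mathcal{F}_n\}_{n\ge0}$ be a discrete-time, real-valued, conditionally symmetric martingale. Assume that there exists a fixed number $d>0$ such that $\xi_k=X_k-X_{k-1}\le d$ almost surely for every integer $k\ge1$. Let $$Q_n=\sum_{k=1}^n\mathbb{E}[\xi_k^2\mid\mathcal{F}_{k-1}]\quad(n\ge1),\qquad Q_0=0.$$ Then for every $z,r>0$, $$\mathbb{P}\Big(\text{there exists an integer } n\ge1 \text{ such that } \max_{1\le k\le n}(X_k-X_0)\ge z \text{ and } Q_n\le r\Big)\le\exp\left(-\frac{z^2}{2r}\,C\Big(\frac{zd}{r}\Big)\right),$$ where $$C(u)=\frac{2\big[u\sinh^{-1}(u)-\sqrt{1+u^2}+1\big]}{u^2},\qquad u>0.$$
   Context: A discrete-time real-valued martingale $\{X_k,\mathcal{F}_k\}_{k\ge0}$ with jumps $\xi_k=X_k-X_{k-1}$, $k\ge1$, is called conditionally symmetric if, for every $k\ge 1$, conditioned on $\mathcal{F}_{k-1}$, the random variable $\xi_k$ is symmetrically distributed around zero (i.e. $\xi_k$ and $-\xi_k$ have the same conditional law given $\mathcal{F}_{k-1}$). Here $\sinh^{-1}$ denotes the inverse hyperbolic sine function. *)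

theory Defs
  imports "HOL-Probability.Probability"
begin

locale discrete_martingale =
  prob_space M + filtration "space M" F
  for M :: "'a measure" and F :: "nat \<Rightarrow> 'a measure" +
  fixes X :: "nat \<Rightarrow> 'a \<Rightarrow> real"
  assumes subalgebra_F: "\<And>n. subalgebra M (F n)"
    and adapted: "\<And>n. X n \<in> borel_measurable (F n)"
    and integrable_X: "\<And>n. integrable M (X n)"
    and cond_exp_step: "\<And>n. AE \<omega> in M. real_cond_exp M (F n) (X (Suc n)) \<omega> = X n \<omega>"

(* Only meaningful for k \<ge> 1; truncated subtraction makes jump X 0 the zero function. *)
definition jump :: "(nat \<Rightarrow> 'a \<Rightarrow> real) \<Rightarrow> nat \<Rightarrow> 'a \<Rightarrow> real" where
  "jump X k \<omega> = X k \<omega> - X (k - 1) \<omega>"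

definition cond_prob_in ::
    "'a measure \<Rightarrow> 'a measure \<Rightarrow> ('a \<Rightarrow> real) \<Rightarrow> real set \<Rightarrow> 'a \<Rightarrow> real" where
  "cond_prob_in M G \<xi> B = real_cond_exp M G (\<lambda>\<omega>. indicator B (\<xi> \<omega>))"

(* Equality of conditional laws: a version of P(\<xi> \<in> B | G) is a version of P(-\<xi> \<in> B | G),
   for each Borel set B. The exceptional null set may depend on B; as the Borel sets of the reals
   are countably generated, this is the same as almost sure equality of the regular
   conditional distributions. *)
definition cond_symmetric :: "'a measure \<Rightarrow> 'a measure \<Rightarrow> ('a \<Rightarrow> real) \<Rightarrow> bool" where
  "cond_symmetric M G \<xi> \<longleftrightarrow>
     (\<forall>B \<in> sets borel. AE \<omega> in M. cond_prob_in M G \<xi> B \<omega> = cond_prob_in M G (\<lambda>\<omega>. - \<xi> \<omega>) B \<omega>)"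

locale cond_symmetric_martingale = discrete_martingale M F X
  for M :: "'a measure" and F :: "nat \<Rightarrow> 'a measure" and X :: "nat \<Rightarrow> 'a \<Rightarrow> real" +
  assumes cond_symmetric_jump: "\<And>k. 1 \<le> k \<Longrightarrow> cond_symmetric M (F (k - 1)) (jump X k)"

definition pred_quad_var ::
    "'a measure \<Rightarrow> (nat \<Rightarrow> 'a measure) \<Rightarrow> (nat \<Rightarrow> 'a \<Rightarrow> real) \<Rightarrow> nat \<Rightarrow> 'a \<Rightarrow> real" where
  "pred_quad_var M F X n \<omega> =
     (\<Sum>k = 1..n. real_cond_exp M (F (k - 1)) (\<lambda>\<omega>'. (jump X k \<omega>')\<^sup>2) \<omega>)"

definition C_fun :: "real \<Rightarrow> real" where
  "C_fun u = 2 * (u * arsinh u - sqrt (1 + u\<^sup>2) + 1) / u\<^sup>2"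

end

theory Submission
  imports Defs
begin

text \<open>
  The bound is a Chernoff bound for a supermartingale with a quadratic compensator. Write
  \<open>\<xi>\<close> for a jump and \<open>G\<close> for the preceding \<sigma>-algebra. Symmetry turns
  the one-sided bound \<open>\<xi> \<le> d\<close> into \<open>\<bar>\<xi>\<bar> \<le> d\<close>
  (\<open>cond_symmetric_abs_le\<close>), and it makes the odd part of the exponential invisible:
  \<open>E[exp (l \<xi>) | G] = E[cosh (l \<xi>) | G]\<close>. Because \<open>(cosh (l x) - 1) / x\<^sup>2\<close> is
  nondecreasing in \<open>\<bar>x\<bar>\<close> for \<open>l \<ge> 0\<close>, the hyperbolic cosine lies on
  \<open>[-d, d]\<close> below the parabola \<open>1 + \<phi> x\<^sup>2\<close> with
  \<open>\<phi> = (cosh (l d) - 1) / d\<^sup>2\<close> (\<open>cosh_le_quadratic\<close>). Hence the conditional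
  exponential moment is at most \<open>exp (\<phi> E[\<xi>\<^sup>2 | G])\<close>
  (\<open>cond_symmetric_exp_moment_le\<close>). The hyperbolic cosine in place of the exponential is
  what distinguishes this bound from Freedman's, and it leads to the inverse hyperbolic sine.

  So \<open>U\<^sub>n = exp (l (X\<^sub>n - X\<^sub>0) - \<phi> Q\<^sub>n)\<close> is a nonnegative supermartingale
  with \<open>U\<^sub>0 = 1\<close>. Almost surely \<open>Q\<close> is nondecreasing; hence if some
  \<open>X\<^sub>k - X\<^sub>0\<close> with \<open>k \<le> n\<close> has reached \<open>z\<close> and \<open>Q\<^sub>n \<le> r\<close>,
  then \<open>Q\<^sub>k \<le> r\<close> already, and \<open>U\<^sub>k \<ge> exp (l z - \<phi> r)\<close>. The maximal inequality
  (\<open>nonneg_supermartingale_maximal_inequality\<close>) bounds the probability that this ever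
  happens by \<open>exp (\<phi> r - l z)\<close>. The exponent is minimal in \<open>l\<close> where
  \<open>sinh (l d) = z d / r\<close>, and its minimum is the claimed exponent
  (\<open>optimal_exponent\<close>).
\<close>

section \<open>Hyperbolic functions\<close>

text \<open>Convexity of \<open>sinh\<close> on the half-line together with \<open>sinh 0 = 0\<close>.\<close>

lemma sinh_mult_le:
  fixes t a :: real
  assumes "0 \<le> t" "t \<le> 1" "0 \<le> a"
  shows "sinh (t * a) \<le> t * sinh a"
proof -
  have "convex_on {0..a} (sinh :: real \<Rightarrow> real)"
  proof (rule f''_ge0_imp_convex)
    show "(sinh has_real_derivative cosh x) (at x)" for x :: real
      by (rule derivative_eq_intros | simp)+
    show "(cosh has_real_derivative sinh x) (at x)" for x :: real
      by (rule derivative_eq_intros | simp)+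
  qed auto
  from convex_onD_Icc[OF this \<open>0 \<le> a\<close> assms(1,2)] show ?thesis by simp
qed

lemma cosh_minus_one_eq:
  fixes y :: real
  shows "cosh y - 1 = 2 * (sinh (y / 2))\<^sup>2"
  using cosh_double[of "y / 2"] cosh_square_eq[of "y / 2"] by simp

text \<open>The quotient \<open>(cosh y - 1) / y\<^sup>2\<close> is half the square of
  \<open>sinh (y/2) / (y/2)\<close>, which grows with \<open>\<bar>y\<bar>\<close>; so the coefficient at the endpoint
  \<open>d\<close> is the largest one. Equality at \<open>x = d\<close> shows that it cannot be improved.\<close>

lemma cosh_le_quadratic:
  fixes l d x :: real
  assumes "0 \<le> l" "0 < d" "\<bar>x\<bar> \<le> d"
  shows "cosh (l * x) \<le> 1 + (cosh (l * d) - 1) / d\<^sup>2 * x\<^sup>2"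
proof -
  have "sinh ((\<bar>x\<bar> / d) * (l * d / 2)) \<le> (\<bar>x\<bar> / d) * sinh (l * d / 2)"
    using assms by (intro sinh_mult_le) auto
  then have "sinh (l * \<bar>x\<bar> / 2) \<le> (\<bar>x\<bar> / d) * sinh (l * d / 2)"
    by (simp add: mult.commute \<open>0 < d\<close>[THEN less_imp_neq, symmetric])
  then have "(sinh (l * \<bar>x\<bar> / 2))\<^sup>2 \<le> ((\<bar>x\<bar> / d) * sinh (l * d / 2))\<^sup>2"
    using assms by (intro power_mono) auto
  also have "\<dots> = (sinh (l * d / 2))\<^sup>2 / d\<^sup>2 * x\<^sup>2"
    by (simp add: power_mult_distrib power_divide)
  finally have "cosh (l * \<bar>x\<bar>) - 1 \<le> (cosh (l * d) - 1) / d\<^sup>2 * x\<^sup>2"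
    unfolding cosh_minus_one_eq by simp
  moreover have "cosh (l * \<bar>x\<bar>) = cosh (l * x)"
    by (simp add: abs_if)
  ultimately show ?thesis by simp
qed

section \<open>The maximal inequality for nonnegative supermartingales\<close>

text \<open>Freeze the process at the value \<open>c\<close> from the first time that it reaches
  \<open>c\<close> or more. Freezing does not raise the value at the crossing time, and before that time the
  supermartingale property applies because \<open>not yet crossed\<close> is an event of the
  current \<sigma>-algebra. The expectation of the frozen process therefore never exceeds that of
  \<open>U 0\<close>, while it is at least \<open>c\<close> times the measure of the crossing event.
  The supermartingale property enters in its integrated form, over events of \<open>F n\<close>.\<close>

lemma (in finite_measure) nonneg_supermartingale_maximal_inequality:
  fixes F :: "nat \<Rightarrow> 'a measure" and U :: "nat \<Rightarrow> 'a \<Rightarrow> real" and c :: real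
  assumes filt: "filtration (space M) F"
    and sub: "\<And>n. subalgebra M (F n)"
    and adapted: "\<And>n. U n \<in> borel_measurable (F n)"
    and int: "\<And>n. integrable M (U n)"
    and nonneg: "\<And>n. AE \<omega> in M. 0 \<le> U n \<omega>"
    and super: "\<And>n A. A \<in> sets (F n) \<Longrightarrow>
          (\<integral>\<omega>\<in>A. U (Suc n) \<omega> \<partial>M) \<le> (\<integral>\<omega>\<in>A. U n \<omega> \<partial>M)"
    and c: "0 \<le> c"
  shows "c * measure M {\<omega> \<in> space M. \<exists>n. c \<le> U n \<omega>} \<le> (\<integral>\<omega>. U 0 \<omega> \<partial>M)"
proof -
  interpret filtration "space M" F by fact
  define A where "A n = {\<omega> \<in> space M. \<forall>k\<le>n. U k \<omega> < c}" for n
  define H where "H n = {\<omega> \<in> space M. \<exists>k\<le>n. c \<le> U k \<omega>}" for n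
  \<comment> \<open>the frozen process\<close>
  define W where "W n \<omega> = (if \<omega> \<in> A n then U n \<omega> else c)" for n \<omega>
  have UM [measurable]: "U n \<in> borel_measurable M" for n
    using int by auto
  have AF: "A n \<in> sets (F n)" for n
  proof -
    have UF: "U k \<in> borel_measurable (F n)" if "k \<le> n" for k
      by (rule measurable_from_subalg[OF _ adapted])
        (simp add: subalgebra_def space_F sets_F_mono[OF that])
    have "{\<omega> \<in> space (F n). \<forall>k\<in>{..n}. U k \<omega> < c} \<in> sets (F n)"
      by (rule sets.sets_Collect_finite_All) (use UF in auto)
    then show ?thesis by (simp only: A_def space_F Ball_def atMost_iff)
  qed
  have AM [measurable]: "A n \<in> sets M" for n
    using AF sub by (auto simp: subalgebra_def)
  have HM [measurable]: "H n \<in> sets M" for n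
    unfolding H_def by measurable
  have int_ind: "integrable M (\<lambda>\<omega>. c * indicator B \<omega>)" if "B \<in> sets M" for B
    using that by (intro integrable_mult_right integrable_real_indicator)
      (simp_all add: emeasure_eq_measure)
  have intif: "integrable M (\<lambda>\<omega>. if \<omega> \<in> A n then U m \<omega> else c)" for n m
    by (rule Bochner_Integration.integrable_bound[where f = "\<lambda>\<omega>. \<bar>U m \<omega>\<bar> + \<bar>c\<bar>"])
      (use int in auto)
  have intW: "integrable M (W n)" for n
    unfolding W_def by (rule intif)
  have split_int: "(\<integral>\<omega>. (if \<omega> \<in> A n then U m \<omega> else c) \<partial>M)
      = (\<integral>\<omega>\<in>A n. U m \<omega> \<partial>M) + c * measure M (space M - A n)" for n m
  proof -
    have "(\<integral>\<omega>. (if \<omega> \<in> A n then U m \<omega> else c) \<partial>M)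
        = (\<integral>\<omega>. indicator (A n) \<omega> *\<^sub>R U m \<omega> + c * indicator (space M - A n) \<omega> \<partial>M)"
      by (rule Bochner_Integration.integral_cong) (auto simp: indicator_def)
    also have "\<dots> = (\<integral>\<omega>. indicator (A n) \<omega> *\<^sub>R U m \<omega> \<partial>M) + c * measure M (space M - A n)"
      by (subst Bochner_Integration.integral_add[OF integrable_mult_indicator[OF AM int] int_ind]) simp_all
    finally show ?thesis by (simp add: set_lebesgue_integral_def)
  qed
  have W_le: "(\<integral>\<omega>. W n \<omega> \<partial>M) \<le> (\<integral>\<omega>. U 0 \<omega> \<partial>M)" for n
  proof (induction n)
    case 0
    show ?case
      by (rule integral_mono[OF intW int]) (auto simp: W_def A_def)
  next
    case (Suc n)
    have "(\<integral>\<omega>. W (Suc n) \<omega> \<partial>M) \<le> (\<integral>\<omega>. (if \<omega> \<in> A n then U (Suc n) \<omega> else c) \<partial>M)"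
      by (rule integral_mono[OF intW intif]) (auto simp: W_def A_def le_Suc_eq)
    also have "\<dots> \<le> (\<integral>\<omega>. W n \<omega> \<partial>M)"
      unfolding W_def split_int using super[OF AF] by simp
    finally show ?case using Suc by simp
  qed
  have H_le: "c * measure M (H n) \<le> (\<integral>\<omega>. U 0 \<omega> \<partial>M)" for n
  proof -
    have "c * measure M (H n) = (\<integral>\<omega>. c * indicator (H n) \<omega> \<partial>M)"
      by simp
    also have "\<dots> \<le> (\<integral>\<omega>. W n \<omega> \<partial>M)"
    proof (rule integral_mono_AE[OF _ intW])
      show "AE \<omega> in M. c * indicator (H n) \<omega> \<le> W n \<omega>"
        using nonneg[of n] by eventually_elim (use c in \<open>auto simp: W_def A_def H_def indicator_def not_le\<close>)
    qed (rule int_ind[OF HM])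
    finally show ?thesis using W_le[of n] by simp
  qed
  have "(\<lambda>n. measure M (H n)) \<longlonglongrightarrow> measure M (\<Union>n. H n)"
    by (rule finite_Lim_measure_incseq) (auto simp: incseq_def H_def intro: order_trans)
  then have "(\<lambda>n. c * measure M (H n)) \<longlonglongrightarrow> c * measure M (\<Union>n. H n)"
    by (rule tendsto_mult_left)
  then have "c * measure M (\<Union>n. H n) \<le> (\<integral>\<omega>. U 0 \<omega> \<partial>M)"
    by (rule LIMSEQ_le_const2) (use H_le in auto)
  moreover have "(\<Union>n. H n) = {\<omega> \<in> space M. \<exists>n. c \<le> U n \<omega>}"
    by (auto simp: H_def)
  ultimately show ?thesis by simp
qed

section \<open>Conditional symmetry\<close>

context finite_measure_subalgebra
begin

text \<open>Equality of the conditional probabilities of all Borel sets integrates, over any event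
  \<open>A\<close> of the conditioning \<sigma>-algebra, to equality of two genuine measures. The
  transfer theorems for image measures then pass from events to functions of \<open>\<xi>\<close>.\<close>

lemma cond_symmetric_distr_eq:
  assumes sym: "cond_symmetric M F \<xi>" and [measurable]: "\<xi> \<in> borel_measurable M"
    and A: "A \<in> sets F"
  shows "distr (restrict_space M A) borel \<xi> = distr (restrict_space M A) borel (\<lambda>\<omega>. - \<xi> \<omega>)"
proof (rule measure_eqI)
  fix B assume "B \<in> sets (distr (restrict_space M A) borel \<xi>)"
  then have B [measurable]: "B \<in> sets borel" by simp
  have AM [measurable]: "A \<in> sets M" using A subalg by (auto simp: subalgebra_def)
  have law: "emeasure (distr (restrict_space M A) borel \<eta>) B
      = ennreal (\<integral>\<omega>\<in>A. cond_prob_in M F \<eta> B \<omega> \<partial>M)"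
    if [measurable]: "\<eta> \<in> borel_measurable M" for \<eta>
  proof -
    have \<eta>A: "\<eta> \<in> borel_measurable (restrict_space M A)"
      by (intro measurable_restrict_space1) simp
    have sp: "space (restrict_space M A) = A"
      using sets.sets_into_space[OF AM] by (auto simp: space_restrict_space)
    have mes [measurable]: "\<eta> -` B \<inter> A \<in> sets M"
    proof -
      have "\<eta> -` B \<inter> A = (\<eta> -` B \<inter> space M) \<inter> A"
        using sets.sets_into_space[OF AM] by auto
      also have "\<dots> \<in> sets M" by measurable
      finally show ?thesis .
    qed
    have "emeasure (distr (restrict_space M A) borel \<eta>) B = emeasure M (\<eta> -` B \<inter> A)"
      using \<eta>A by (simp add: emeasure_distr sp emeasure_restrict_space)
    also have "\<dots> = ennreal (\<integral>\<omega>. indicator (\<eta> -` B \<inter> A) \<omega> \<partial>M)"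
      by (simp add: emeasure_eq_measure Int_absorb2 sets.sets_into_space)
    also have "(\<integral>\<omega>. indicator (\<eta> -` B \<inter> A) \<omega> \<partial>M) = (\<integral>\<omega>\<in>A. (indicator B (\<eta> \<omega>) :: real) \<partial>M)"
      unfolding set_lebesgue_integral_def
      by (rule Bochner_Integration.integral_cong) (auto simp: indicator_def)
    also have "\<dots> = (\<integral>\<omega>\<in>A. cond_prob_in M F \<eta> B \<omega> \<partial>M)"
      unfolding cond_prob_in_def
      by (rule real_cond_exp_intA[OF _ A]) (rule integrable_const_bound[where B = 1]; simp)
    finally show ?thesis .
  qed
  have "(\<integral>\<omega>\<in>A. cond_prob_in M F \<xi> B \<omega> \<partial>M) = (\<integral>\<omega>\<in>A. cond_prob_in M F (\<lambda>\<omega>. - \<xi> \<omega>) B \<omega> \<partial>M)"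
    unfolding set_lebesgue_integral_def
    using sym B unfolding cond_symmetric_def
    by (intro integral_cong_AE) (auto simp: cond_prob_in_def)
  then show "emeasure (distr (restrict_space M A) borel \<xi>) B
      = emeasure (distr (restrict_space M A) borel (\<lambda>\<omega>. - \<xi> \<omega>)) B"
    by (simp add: law)
qed simp

text \<open>Taking the whole space as the conditioning event, \<open>\<xi>\<close> and \<open>- \<xi>\<close>
  have the same law, so an upper bound for one is an upper bound for the other.\<close>

lemma cond_symmetric_abs_le:
  assumes sym: "cond_symmetric M F \<xi>" and [measurable]: "\<xi> \<in> borel_measurable M"
    and le: "AE \<omega> in M. \<xi> \<omega> \<le> d"
  shows "AE \<omega> in M. \<bar>\<xi> \<omega>\<bar> \<le> d"
proof -
  have "space M \<in> sets F"
    using subalg sets.top[of F] by (simp add: subalgebra_def)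
  from cond_symmetric_distr_eq[OF sym _ this]
  have eq: "distr M borel \<xi> = distr M borel (\<lambda>\<omega>. - \<xi> \<omega>)"
    by (simp add: restrict_space_def measure_of_of_measure)
  have "AE x in distr M borel \<xi>. x \<le> d"
    using le by (subst AE_distr_iff) auto
  then have "AE \<omega> in M. - \<xi> \<omega> \<le> d"
    unfolding eq by (subst (asm) AE_distr_iff) auto
  with le show ?thesis by eventually_elim auto
qed

lemma cond_symmetric_real_cond_exp:
  fixes f :: "real \<Rightarrow> real"
  assumes sym: "cond_symmetric M F \<xi>" and [measurable]: "\<xi> \<in> borel_measurable M"
    and f [measurable]: "f \<in> borel_measurable borel"
    and int: "integrable M (\<lambda>\<omega>. f (\<xi> \<omega>))" and int': "integrable M (\<lambda>\<omega>. f (- \<xi> \<omega>))"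
  shows "AE \<omega> in M. real_cond_exp M F (\<lambda>\<omega>. f (\<xi> \<omega>)) \<omega> = real_cond_exp M F (\<lambda>\<omega>. f (- \<xi> \<omega>)) \<omega>"
proof (rule real_cond_exp_charact)
  fix A assume A: "A \<in> sets F"
  have AM: "A \<in> sets M" using A subalg by (auto simp: subalgebra_def)
  have res: "(\<integral>\<omega>\<in>A. f (\<eta> \<omega>) \<partial>M) = (\<integral>x. f x \<partial>distr (restrict_space M A) borel \<eta>)"
    if [measurable]: "\<eta> \<in> borel_measurable M" for \<eta>
    by (subst integral_distr)
      (auto simp: set_lebesgue_integral_def integral_restrict_space AM intro!: measurable_restrict_space1)
  have "(\<integral>\<omega>\<in>A. f (\<xi> \<omega>) \<partial>M) = (\<integral>\<omega>\<in>A. f (- \<xi> \<omega>) \<partial>M)"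
    using cond_symmetric_distr_eq[OF sym _ A] by (simp add: res)
  also have "\<dots> = (\<integral>\<omega>\<in>A. real_cond_exp M F (\<lambda>\<omega>. f (- \<xi> \<omega>)) \<omega> \<partial>M)"
    by (rule real_cond_exp_intA[OF int' A])
  finally show "(\<integral>\<omega>\<in>A. f (\<xi> \<omega>) \<partial>M) = (\<integral>\<omega>\<in>A. real_cond_exp M F (\<lambda>\<omega>. f (- \<xi> \<omega>)) \<omega> \<partial>M)" .
qed (use int int' in auto)

text \<open>By symmetry, twice the conditional moment is that of
  \<open>exp (l \<xi>) + exp (- l \<xi>) = 2 cosh (l \<xi>)\<close>, which the parabola bounds by a constant plus a
  multiple of \<open>\<xi>\<^sup>2\<close>; finally \<open>1 + x \<le> exp x\<close>.\<close>

lemma cond_symmetric_exp_moment_le: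
  fixes l d :: real
  assumes sym: "cond_symmetric M F \<xi>" and [measurable]: "\<xi> \<in> borel_measurable M"
    and le: "AE \<omega> in M. \<xi> \<omega> \<le> d" and d: "0 < d" and l: "0 \<le> l"
  shows "AE \<omega> in M. real_cond_exp M F (\<lambda>\<omega>. exp (l * \<xi> \<omega>)) \<omega>
           \<le> exp ((cosh (l * d) - 1) / d\<^sup>2 * real_cond_exp M F (\<lambda>\<omega>. (\<xi> \<omega>)\<^sup>2) \<omega>)"
proof -
  let ?\<phi> = "(cosh (l * d) - 1) / d\<^sup>2"
  let ?E = "real_cond_exp M F"
  have bd: "AE \<omega> in M. \<bar>\<xi> \<omega>\<bar> \<le> d" by (rule cond_symmetric_abs_le[OF sym _ le]) simp
  have bdl: "AE \<omega> in M. \<bar>l * \<xi> \<omega>\<bar> \<le> l * d"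
    using bd by eventually_elim (use l in \<open>simp add: abs_mult mult_left_mono\<close>)
  have i1: "integrable M (\<lambda>\<omega>. exp (l * \<xi> \<omega>))" 
    by (rule integrable_const_bound[where B = "exp (l * d)"]) (use bdl in auto)
  have i2: "integrable M (\<lambda>\<omega>. exp (l * - \<xi> \<omega>))" 
    by (rule integrable_const_bound[where B = "exp (l * d)"]) (use bdl in auto)
  have i3: "integrable M (\<lambda>\<omega>. (\<xi> \<omega>)\<^sup>2)" 
  proof (rule integrable_const_bound[where B = "d\<^sup>2"])
    show "AE \<omega> in M. norm ((\<xi> \<omega>)\<^sup>2) \<le> d\<^sup>2"
      using bd by eventually_elim (simp add: abs_le_square_iff[symmetric] d less_imp_le)
  qed simp
  have i4: "integrable M (\<lambda>\<omega>. ?\<phi> * (\<xi> \<omega>)\<^sup>2)" using i3 by simp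
  have i5: "integrable M (\<lambda>\<omega>. 2 + 2 * (?\<phi> * (\<xi> \<omega>)\<^sup>2))"
    by (intro Bochner_Integration.integrable_add integrable_mult_right i3 integrable_const)
  have "AE \<omega> in M. ?E (\<lambda>\<omega>. exp (l * \<xi> \<omega>)) \<omega> = ?E (\<lambda>\<omega>. exp (l * - \<xi> \<omega>)) \<omega>"
    by (rule cond_symmetric_real_cond_exp[where f = "\<lambda>x. exp (l * x)", OF sym _ _ i1 i2]) auto
  moreover have "AE \<omega> in M. ?E (\<lambda>\<omega>. exp (l * \<xi> \<omega>) + exp (l * - \<xi> \<omega>)) \<omega>
      = ?E (\<lambda>\<omega>. exp (l * \<xi> \<omega>)) \<omega> + ?E (\<lambda>\<omega>. exp (l * - \<xi> \<omega>)) \<omega>"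
    by (rule real_cond_exp_add[OF i1 i2])
  moreover have "AE \<omega> in M. ?E (\<lambda>\<omega>. exp (l * \<xi> \<omega>) + exp (l * - \<xi> \<omega>)) \<omega>
      \<le> ?E (\<lambda>\<omega>. 2 + 2 * (?\<phi> * (\<xi> \<omega>)\<^sup>2)) \<omega>"
  proof (rule real_cond_exp_mono)
    show "AE \<omega> in M. exp (l * \<xi> \<omega>) + exp (l * - \<xi> \<omega>) \<le> 2 + 2 * (?\<phi> * (\<xi> \<omega>)\<^sup>2)"
      using bd
    proof eventually_elim
      case (elim \<omega>)
      have "exp (l * \<xi> \<omega>) + exp (l * - \<xi> \<omega>) = 2 * cosh (l * \<xi> \<omega>)"
        by (simp add: cosh_def)
      with cosh_le_quadratic[OF l d elim] show ?case by simp
    qed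
  qed (rule Bochner_Integration.integrable_add[OF i1 i2] i5)+
  moreover have "AE \<omega> in M. ?E (\<lambda>\<omega>. 2 + 2 * (?\<phi> * (\<xi> \<omega>)\<^sup>2)) \<omega>
      = ?E (\<lambda>\<omega>. 2) \<omega> + ?E (\<lambda>\<omega>. 2 * (?\<phi> * (\<xi> \<omega>)\<^sup>2)) \<omega>"
    by (intro real_cond_exp_add integrable_mult_right i3 integrable_const)
  moreover have "AE \<omega> in M. ?E (\<lambda>\<omega>. 2) \<omega> = 2"
    by (rule real_cond_exp_F_meas) auto
  moreover have "AE \<omega> in M. ?E (\<lambda>\<omega>. 2 * (?\<phi> * (\<xi> \<omega>)\<^sup>2)) \<omega> = 2 * ?E (\<lambda>\<omega>. ?\<phi> * (\<xi> \<omega>)\<^sup>2) \<omega>"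
    by (rule real_cond_exp_cmult[OF i4])
  moreover have "AE \<omega> in M. ?E (\<lambda>\<omega>. ?\<phi> * (\<xi> \<omega>)\<^sup>2) \<omega> = ?\<phi> * ?E (\<lambda>\<omega>. (\<xi> \<omega>)\<^sup>2) \<omega>"
    by (rule real_cond_exp_cmult[OF i3])
  ultimately show ?thesis
  proof eventually_elim
    case (elim \<omega>)
    then have "?E (\<lambda>\<omega>. exp (l * \<xi> \<omega>)) \<omega> \<le> 1 + ?\<phi> * ?E (\<lambda>\<omega>. (\<xi> \<omega>)\<^sup>2) \<omega>" by linarith
    also have "\<dots> \<le> exp (?\<phi> * ?E (\<lambda>\<omega>. (\<xi> \<omega>)\<^sup>2) \<omega>)" by (rule exp_ge_add_one_self)
    finally show ?case .
  qed
qed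

end

section \<open>Optimising the exponent\<close>

text \<open>The value of \<open>l\<close> is the zero of the derivative
  \<open>sinh (l d) / d * r - z\<close> of the left-hand side.\<close>

lemma optimal_exponent:
  fixes z d r l :: real
  assumes "0 < z" "0 < d" "0 < r" and l_def: "l = arsinh (z * d / r) / d"
  shows "(cosh (l * d) - 1) / d\<^sup>2 * r - l * z = - (z\<^sup>2 / (2 * r)) * C_fun (z * d / r)"
proof -
  define u where "u = z * d / r"
  have u: "u > 0" using assms by (simp add: u_def)
  have z: "z = u * r / d" using assms by (simp add: u_def)
  have ch: "cosh (arsinh u) = sqrt (1 + u\<^sup>2)"
    by (simp add: cosh_arsinh_real add.commute)
  have "l * d = arsinh u" using assms by (simp add: l_def u_def)
  then have "(cosh (l * d) - 1) / d\<^sup>2 * r - l * z = (sqrt (1 + u\<^sup>2) - 1) / d\<^sup>2 * r - (arsinh u / d) * (u * r / d)"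
    by (simp add: ch z[symmetric]) (simp add: l_def u_def)
  also have "\<dots> = - ((u * r / d)\<^sup>2 / (2 * r)) * C_fun u"
    using u assms by (simp add: C_fun_def field_simps power2_eq_square)
  finally show ?thesis unfolding z[symmetric] unfolding u_def .
qed

section \<open>The exponential supermartingale\<close>

context cond_symmetric_martingale
begin

lemma finite_measure_subalgebra_F: "finite_measure_subalgebra M (F n)"
  by unfold_locales (rule subalgebra_F)

lemma X_measurable_of_le: "k \<le> n \<Longrightarrow> X k \<in> borel_measurable (F n)"
  by (rule measurable_from_subalg[OF _ adapted]) (simp add: subalgebra_def space_F sets_F_mono)

lemma X_measurable_M [measurable]: "X n \<in> borel_measurable M"
  using integrable_X by auto

lemma jump_measurable_M [measurable]: "jump X k \<in> borel_measurable M"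
  unfolding jump_def[abs_def] by measurable

text \<open>The process \<open>Q\<close> is predictable: its value at time \<open>Suc m\<close> is already known
  at time \<open>m\<close>.\<close>

lemma pred_quad_var_measurable: "n \<le> Suc m \<Longrightarrow> pred_quad_var M F X n \<in> borel_measurable (F m)"
  unfolding pred_quad_var_def[abs_def]
proof (rule borel_measurable_sum)
  fix k assume "n \<le> Suc m" "k \<in> {1..n}"
  then have "k - 1 \<le> m" by auto
  then have "subalgebra (F m) (F (k - 1))"
    by (simp add: subalgebra_def space_F sets_F_mono)
  then show "real_cond_exp M (F (k - 1)) (\<lambda>\<omega>'. (jump X k \<omega>')\<^sup>2) \<in> borel_measurable (F m)"
    by (rule measurable_from_subalg) simp
qed

lemma pred_quad_var_mono_AE:
  "AE \<omega> in M. \<forall>k n. k \<le> n \<longrightarrow> pred_quad_var M F X k \<omega> \<le> pred_quad_var M F X n \<omega>"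
proof -
  have "AE \<omega> in M. 0 \<le> real_cond_exp M (F (k - 1)) (\<lambda>\<omega>'. (jump X k \<omega>')\<^sup>2) \<omega>" for k
    using finite_measure_subalgebra_F by (intro sigma_finite_subalgebra.real_cond_exp_pos)
      (auto intro: finite_measure_subalgebra_is_sigma_finite)
  then have "AE \<omega> in M. \<forall>k. 0 \<le> real_cond_exp M (F (k - 1)) (\<lambda>\<omega>'. (jump X k \<omega>')\<^sup>2) \<omega>"
    by (simp add: AE_all_countable)
  then show ?thesis
    by eventually_elim (auto simp: pred_quad_var_def intro!: sum_mono2)
qed

definition exp_supermart :: "real \<Rightarrow> real \<Rightarrow> nat \<Rightarrow> 'a \<Rightarrow> real" where
  "exp_supermart l d n \<omega> =
     exp (l * (X n \<omega> - X 0 \<omega>) - (cosh (l * d) - 1) / d\<^sup>2 * pred_quad_var M F X n \<omega>)"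

lemma exp_supermart_measurable: "exp_supermart l d n \<in> borel_measurable (F n)"
proof -
  have [measurable]: "X n \<in> borel_measurable (F n)" "X 0 \<in> borel_measurable (F n)"
    "pred_quad_var M F X n \<in> borel_measurable (F n)"
    by (auto intro: X_measurable_of_le pred_quad_var_measurable)
  show ?thesis unfolding exp_supermart_def[abs_def] by measurable
qed

context
  fixes l d :: real
  assumes d: "0 < d" and l: "0 \<le> l"
    and jump_le: "\<And>k. 1 \<le> k \<Longrightarrow> AE \<omega> in M. jump X k \<omega> \<le> d"
begin

text \<open>Up to time \<open>n\<close> the martingale gains at most \<open>n d\<close>, and the compensator only
  lowers the exponent; so each variable is almost surely bounded.\<close>

lemma integrable_exp_supermart: "integrable M (exp_supermart l d n)"
proof (rule integrable_const_bound[where B = "exp (l * (real n * d))"])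
  let ?\<phi> = "(cosh (l * d) - 1) / d\<^sup>2"
  have "AE \<omega> in M. \<forall>k. jump X (Suc k) \<omega> \<le> d"
    using jump_le by (simp add: AE_all_countable)
  then show "AE \<omega> in M. norm (exp_supermart l d n \<omega>) \<le> exp (l * (real n * d))"
    using pred_quad_var_mono_AE
  proof eventually_elim
    case (elim \<omega>)
    have "X n \<omega> - X 0 \<omega> \<le> real n * d"
    proof (induction n)
      case (Suc n)
      with elim(1)[rule_format, of n] show ?case by (simp add: jump_def algebra_simps)
    qed simp
    then have "l * (X n \<omega> - X 0 \<omega>) \<le> l * (real n * d)" using l by (rule mult_left_mono)
    moreover have "0 \<le> pred_quad_var M F X n \<omega>"
      using elim(2)[rule_format, of 0 n] by (simp add: pred_quad_var_def)
    then have "0 \<le> ?\<phi> * pred_quad_var M F X n \<omega>"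
      using d by (simp add: cosh_real_ge_1)
    ultimately show ?case by (simp add: exp_supermart_def)
  qed
  show "exp_supermart l d n \<in> borel_measurable M"
    by (rule measurable_from_subalg[OF subalgebra_F exp_supermart_measurable])
qed

text \<open>Passing from \<open>n\<close> to \<open>Suc n\<close> multiplies the process by
  \<open>exp (l \<xi>) exp (- \<phi> q)\<close>, where \<open>q\<close> is the conditional second moment of the new jump
  \<open>\<xi>\<close>. All but \<open>exp (l \<xi>)\<close> is measurable at time \<open>n\<close>, and the
  second factor was chosen to cancel the bound on the conditional moment of the first.\<close>

lemma exp_supermart_set_integral_Suc_le:
  assumes A: "A \<in> sets (F n)"
  shows "(\<integral>\<omega>\<in>A. exp_supermart l d (Suc n) \<omega> \<partial>M) \<le> (\<integral>\<omega>\<in>A. exp_supermart l d n \<omega> \<partial>M)"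
proof -
  interpret G: finite_measure_subalgebra M "F n" by (rule finite_measure_subalgebra_F)
  let ?\<phi> = "(cosh (l * d) - 1) / d\<^sup>2"
  let ?q = "real_cond_exp M (F n) (\<lambda>\<omega>. (jump X (Suc n) \<omega>)\<^sup>2)"
  let ?e = "\<lambda>\<omega>. exp (l * jump X (Suc n) \<omega>)"
  \<comment> \<open>the factor of the next value that is known at time \<open>n\<close>\<close>
  define Y where "Y \<omega> = indicator A \<omega> * exp_supermart l d n \<omega> * exp (- (?\<phi> * ?q \<omega>))" for \<omega>
  have AM: "A \<in> sets M" using A subalgebra_F by (auto simp: subalgebra_def)
  have YF: "Y \<in> borel_measurable (F n)"
    unfolding Y_def[abs_def] using A exp_supermart_measurable[of l d n] by measurable
  have Y_mult: "Y \<omega> * ?e \<omega> = indicator A \<omega> *\<^sub>R exp_supermart l d (Suc n) \<omega>" for \<omega>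
  proof -
    have "pred_quad_var M F X (Suc n) \<omega> = pred_quad_var M F X n \<omega> + ?q \<omega>"
      by (simp add: pred_quad_var_def)
    moreover have "X (Suc n) \<omega> = X n \<omega> + jump X (Suc n) \<omega>"
      by (simp add: jump_def)
    moreover have "exp (l * (x + j - y) - \<phi> * (p + q))
        = exp (l * (x - y) - \<phi> * p) * exp (- (\<phi> * q)) * exp (l * j)" for x y j \<phi> p q :: real
      unfolding exp_add[symmetric] by (rule arg_cong[where f = exp]) algebra
    ultimately show ?thesis
      unfolding Y_def exp_supermart_def by (simp only: mult.assoc real_scaleR_def)
  qed
  have intA: "integrable M (\<lambda>\<omega>. indicator A \<omega> *\<^sub>R exp_supermart l d m \<omega>)" for m
    by (rule integrable_mult_indicator[OF AM integrable_exp_supermart])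
  have intY: "integrable M (\<lambda>\<omega>. Y \<omega> * ?e \<omega>)"
    unfolding Y_mult by (rule intA)
  have em: "?e \<in> borel_measurable M" by measurable
  have "(\<integral>\<omega>\<in>A. exp_supermart l d (Suc n) \<omega> \<partial>M) = (\<integral>\<omega>. Y \<omega> * ?e \<omega> \<partial>M)"
    by (simp add: set_lebesgue_integral_def Y_mult)
  also have "\<dots> = (\<integral>\<omega>. Y \<omega> * real_cond_exp M (F n) ?e \<omega> \<partial>M)"
    by (rule G.real_cond_exp_intg(2)[OF intY YF em, symmetric])
  also have "\<dots> \<le> (\<integral>\<omega>. indicator A \<omega> *\<^sub>R exp_supermart l d n \<omega> \<partial>M)"
  proof (rule integral_mono_AE[OF G.real_cond_exp_intg(1)[OF intY YF em] intA])
    have "AE \<omega> in M. real_cond_exp M (F n) ?e \<omega> \<le> exp (?\<phi> * ?q \<omega>)"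
      using cond_symmetric_jump[of "Suc n"] jump_le[of "Suc n"] d l
      by (intro G.cond_symmetric_exp_moment_le) auto
    then show "AE \<omega> in M. Y \<omega> * real_cond_exp M (F n) ?e \<omega> \<le> indicator A \<omega> *\<^sub>R exp_supermart l d n \<omega>"
    proof eventually_elim
      case (elim \<omega>)
      have "0 \<le> Y \<omega>" by (simp add: Y_def exp_supermart_def)
      from mult_left_mono[OF elim this]
      have "Y \<omega> * real_cond_exp M (F n) ?e \<omega> \<le> Y \<omega> * exp (?\<phi> * ?q \<omega>)" .
      also have "\<dots> = indicator A \<omega> *\<^sub>R exp_supermart l d n \<omega>"
        unfolding Y_def by (simp only: mult.assoc exp_add[symmetric]) simp
      finally show ?case .
    qed
  qed
  finally show ?thesis by (simp add: set_lebesgue_integral_def)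
qed

text \<open>The bound before optimisation. Where the martingale reaches \<open>z\<close> at a time
  \<open>k \<le> n\<close>, monotonicity of \<open>Q\<close> carries the constraint from \<open>n\<close> back to
  \<open>k\<close>, so the supermartingale crosses \<open>exp (l z - \<phi> r)\<close> at time \<open>k\<close>.
  The almost sure inclusion of events suffices, since the larger one is measurable.\<close>

lemma exponential_tail_bound:
  "measure M {\<omega> \<in> space M. \<exists>n\<ge>1.
      Max ((\<lambda>k. X k \<omega> - X 0 \<omega>) ` {1..n}) \<ge> z \<and> pred_quad_var M F X n \<omega> \<le> r}
   \<le> exp ((cosh (l * d) - 1) / d\<^sup>2 * r - l * z)"
proof -
  let ?\<phi> = "(cosh (l * d) - 1) / d\<^sup>2"
  let ?U = "exp_supermart l d"
  define c where "c = exp (l * z - ?\<phi> * r)"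
  have UM [measurable]: "?U n \<in> borel_measurable M" for n
    using integrable_exp_supermart by auto
  let ?S = "{\<omega> \<in> space M. \<exists>n\<ge>1.
      Max ((\<lambda>k. X k \<omega> - X 0 \<omega>) ` {1..n}) \<ge> z \<and> pred_quad_var M F X n \<omega> \<le> r}"
  let ?T = "{\<omega> \<in> space M. \<exists>n. c \<le> ?U n \<omega>}"
  have "measure M ?S \<le> measure M ?T"
  proof (rule finite_measure_mono_AE)
    show "AE \<omega> in M. \<omega> \<in> ?S \<longrightarrow> \<omega> \<in> ?T"
      using pred_quad_var_mono_AE
    proof eventually_elim
      case (elim \<omega>)
      show ?case
      proof
        assume "\<omega> \<in> ?S"
        then obtain n where n: "n \<ge> 1" "z \<le> Max ((\<lambda>k. X k \<omega> - X 0 \<omega>) ` {1..n})"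
          "pred_quad_var M F X n \<omega> \<le> r" and \<omega>: "\<omega> \<in> space M" by auto
        then obtain k where k: "k \<in> {1..n}" "z \<le> X k \<omega> - X 0 \<omega>"
          by (subst (asm) Max_ge_iff) auto
        then have "pred_quad_var M F X k \<omega> \<le> r"
          using elim n(3) by (meson atLeastAtMost_iff order_trans)
        then have "?\<phi> * pred_quad_var M F X k \<omega> \<le> ?\<phi> * r"
          by (intro mult_left_mono) (auto simp: cosh_real_ge_1)
        moreover have "l * z \<le> l * (X k \<omega> - X 0 \<omega>)" using k l by (intro mult_left_mono)
        ultimately have "c \<le> ?U k \<omega>" unfolding c_def exp_supermart_def by simp
        then show "\<omega> \<in> ?T" using \<omega> by auto
      qed
    qed
  qed measurable
  moreover have "c * measure M ?T \<le> (\<integral>\<omega>. ?U 0 \<omega> \<partial>M)"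
  proof (rule nonneg_supermartingale_maximal_inequality)
    show "filtration (space M) F" ..
  qed (auto simp: subalgebra_F exp_supermart_measurable integrable_exp_supermart c_def
      exp_supermart_set_integral_Suc_le, simp add: exp_supermart_def)
  moreover have "(\<integral>\<omega>. ?U 0 \<omega> \<partial>M) = 1"
    by (simp add: exp_supermart_def pred_quad_var_def prob_space)
  moreover have "c > 0" by (simp add: c_def)
  ultimately have "measure M ?S \<le> 1 / c"
    by (simp add: field_simps) (meson mult_left_mono less_imp_le order_trans)
  also have "1 / c = exp (?\<phi> * r - l * z)"
    by (simp add: c_def exp_diff)
  finally show ?thesis .
qed

end

end

section \<open>The tail bound\<close>

theorem theorem4:
  fixes M :: "'a measure" and F :: "nat \<Rightarrow> 'a measure"
    and X :: "nat \<Rightarrow> 'a \<Rightarrow> real" and d z r :: real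
  assumes "cond_symmetric_martingale M F X"
    and "d > 0"
    and "\<And>k. k \<ge> 1 \<Longrightarrow> AE \<omega> in M. jump X k \<omega> \<le> d"
    and "z > 0" and "r > 0"
  shows "measure M {\<omega> \<in> space M. \<exists>n\<ge>1.
            Max ((\<lambda>k. X k \<omega> - X 0 \<omega>) ` {1..n}) \<ge> z \<and> pred_quad_var M F X n \<omega> \<le> r}
         \<le> exp (- (z\<^sup>2 / (2 * r)) * C_fun (z * d / r))"
proof -
  interpret cond_symmetric_martingale M F X by (rule assms(1))
  have "0 \<le> arsinh (z * d / r) / d"
    using assms(2,4,5) by (simp add: less_imp_le)
  note exponential_tail_bound[OF assms(2) this assms(3), of z r]
  also note optimal_exponent[OF assms(4,2,5) refl]
  finally show ?thesis .
qed

end
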